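(* Let $X$ be a complex Banach space, let $A:\operatorname{dom}(A)\subseteq X\to X$ and $B:\operatorname{dom}(B)\subseteq X\to X$ be closed linear operators with $\rho(B)\neq\emptyset$, and let $Y$ be a Banach space continuously embedded in $X$ such that $\operatorname{dom}(A)\subseteq\operatorname{dom}(B^2)\cap Y$, $B(\operatorname{dom}(A))\subseteq Y\subseteq\operatorname{dom}(B)$, and the operator $G=\begin{bmatrix}-B & I \\ A+B^2 & -B\end{bmatrix}$ with domain $\operatorname{dom}(A)\times Y$ generates a $C_0$-group $\{\mathcal T(t)\}_{t\in\mathbb R}$ on $Y\times X$. Then for each $x\in\operatorname{dom}(B)$ and $y\in X$ the initial value problem $$u''(t)+2Bu'(t)=Au(t),\ t\in\mathbb R,\qquad u(0)=x,\ u'(0)=y,$$ has a unique integral mild solution, given by $$u_{x,y}(t)=C_{A,B}(t)x+S_{A,B}(t)y,\qquad t\in\mathbb R.$$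
   Context: Write $\mathcal T(t)=\begin{bmatrix}T_{11}(t) & T_{12}(t) \\ T_{21}(t) & T_{22}(t)\end{bmatrix}$ in block form with respect to $Y\times X$. The generalized cosine and sine families $C_{A,B}(t)\in\mathcal B(\operatorname{dom}(B),X)$ (where $\operatorname{dom}(B)$ has the graph norm) and $S_{A,B}(t)\in\mathcal B(X)$ are given by $$C_{A,B}(t)x=T_{22}(t)x-BT_{12}(t)x+2T_{12}(t)Bx\ (x\in\operatorname{dom}(B)),\qquad S_{A,B}(t)x=T_{12}(t)x\ (x\in X),\quad t\in\mathbb R.$$ For $x\in\operatorname{dom}(B)$ and $y\in X$, a function $u\in\mathcal C(\mathbb R,X)$ is an integral mild solution of the initial value problem if for all $t\in\mathbb R$: $\int_0^tu(s)\,ds\in\operatorname{dom}(B)$ and $\int_0^t(t-s)u(s)\,ds\in\operatorname{dom}(A)$; the maps $t\mapsto B\int_0^tu(s)\,ds$ and $t\mapsto A\int_0^t(t-s)u(s)\,ds$ belong to $\mathcal C(\mathbb R,X)$; and $$u(t)+2B\int_0^tu(s)\,ds=A\int_0^t(t-s)u(s)\,ds+x+t(y+2Bx)\quad\text{for all }t\in\mathbb R.$$ *)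

theory Defs
  imports "HOL-Analysis.Analysis"
begin

section \<open>Complex Banach spaces\<close>

class complex_vector = real_vector +
  fixes scaleC :: "complex \<Rightarrow> 'a \<Rightarrow> 'a" (infixr \<open>*\<^sub>C\<close> 75)
  assumes scaleC_add_right: "c *\<^sub>C (x + y) = c *\<^sub>C x + c *\<^sub>C y"
    and scaleC_add_left: "(c + d) *\<^sub>C x = c *\<^sub>C x + d *\<^sub>C x"
    and scaleC_scaleC: "c *\<^sub>C d *\<^sub>C x = (c * d) *\<^sub>C x"
    and scaleC_one: "1 *\<^sub>C x = x"
    and scaleR_scaleC: "r *\<^sub>R x = complex_of_real r *\<^sub>C x"

class complex_normed_vector = complex_vector + real_normed_vector +
  assumes norm_scaleC: "norm (c *\<^sub>C x) = cmod c * norm x"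

class complex_banach = complex_normed_vector + banach

instantiation prod :: (complex_vector, complex_vector) complex_vector
begin

definition scaleC_prod :: "complex \<Rightarrow> 'a \<times> 'b \<Rightarrow> 'a \<times> 'b"
  where "scaleC_prod c z = (c *\<^sub>C fst z, c *\<^sub>C snd z)"

instance
  by standard
    (simp_all add: scaleC_prod_def prod_eq_iff scaleC_add_right scaleC_add_left
      scaleC_scaleC scaleC_one scaleR_scaleC)

end

instance prod :: (complex_normed_vector, complex_normed_vector) complex_normed_vector
proof
  fix c :: complex and z :: "'a \<times> 'b"
  have "norm (c *\<^sub>C z) = sqrt ((cmod c)\<^sup>2 * ((norm (fst z))\<^sup>2 + (norm (snd z))\<^sup>2))"
    by (simp add: scaleC_prod_def norm_prod_def norm_scaleC power_mult_distrib distrib_left)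
  then show "norm (c *\<^sub>C z) = cmod c * norm z"
    by (simp add: norm_prod_def real_sqrt_mult)
qed

instance prod :: (complex_banach, complex_banach) complex_banach ..

definition bounded_clinear :: "('a::complex_normed_vector \<Rightarrow> 'b::complex_normed_vector) \<Rightarrow> bool"
  where "bounded_clinear f \<longleftrightarrow> bounded_linear f \<and> (\<forall>c x. f (c *\<^sub>C x) = c *\<^sub>C f x)"


section \<open>Unbounded operators\<close>

text \<open>An operator \<open>F : dom(F) \<subseteq> X \<rightarrow> X\<close> is given by its domain \<open>D\<close> and a function \<open>F\<close> whose
  values outside \<open>D\<close> are irrelevant.\<close>

definition linear_operator :: "'a::complex_vector set \<Rightarrow> ('a \<Rightarrow> 'b::complex_vector) \<Rightarrow> bool"
  where "linear_operator D F \<longleftrightarrow>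
    0 \<in> D \<and>
    (\<forall>x\<in>D. \<forall>y\<in>D. x + y \<in> D \<and> F (x + y) = F x + F y) \<and>
    (\<forall>c. \<forall>x\<in>D. c *\<^sub>C x \<in> D \<and> F (c *\<^sub>C x) = c *\<^sub>C F x)"

definition operator_graph :: "'a set \<Rightarrow> ('a \<Rightarrow> 'b) \<Rightarrow> ('a \<times> 'b) set"
  where "operator_graph D F = {(x, F x) | x. x \<in> D}"

definition closed_linear_operator ::
    "'a::complex_normed_vector set \<Rightarrow> ('a \<Rightarrow> 'b::complex_normed_vector) \<Rightarrow> bool"
  where "closed_linear_operator D F \<longleftrightarrow> linear_operator D F \<and> closed (operator_graph D F)"

definition resolvent_set :: "'a::complex_normed_vector set \<Rightarrow> ('a \<Rightarrow> 'a) \<Rightarrow> complex set"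
  where "resolvent_set D F =
    {\<mu>. \<exists>R. bounded_clinear R \<and>
      (\<forall>y. R y \<in> D \<and> \<mu> *\<^sub>C R y - F (R y) = y) \<and>
      (\<forall>x\<in>D. R (\<mu> *\<^sub>C x - F x) = x)}"

definition dom_square :: "'a set \<Rightarrow> ('a \<Rightarrow> 'a) \<Rightarrow> 'a set"
  where "dom_square D F = {x \<in> D. F x \<in> D}"


section \<open>\<open>C\<^sub>0\<close>-groups\<close>

definition C0_group :: "(real \<Rightarrow> 'a::complex_banach \<Rightarrow> 'a) \<Rightarrow> bool"
  where "C0_group T \<longleftrightarrow>
    (\<forall>t. bounded_clinear (T t)) \<and>
    (\<forall>x. T 0 x = x) \<and>
    (\<forall>s t x. T (s + t) x = T s (T t x)) \<and>
    (\<forall>x. continuous_on UNIV (\<lambda>t. T t x))"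

definition generator_graph :: "(real \<Rightarrow> 'a::complex_banach \<Rightarrow> 'a) \<Rightarrow> ('a \<times> 'a) set"
  where "generator_graph T = {(x, z). ((\<lambda>h. (T h x - x) /\<^sub>R h) \<longlongrightarrow> z) (at 0)}"

definition generates_C0_group ::
    "'a::complex_banach set \<Rightarrow> ('a \<Rightarrow> 'a) \<Rightarrow> (real \<Rightarrow> 'a \<Rightarrow> 'a) \<Rightarrow> bool"
  where "generates_C0_group D G T \<longleftrightarrow> C0_group T \<and> generator_graph T = operator_graph D G"


section \<open>The operator matrix and the generalized cosine and sine families\<close>

text \<open>The space \<open>Y\<close> carries its own norm, so it is a type \<open>'y\<close> of its own, together with an
  embedding \<open>j\<close> into \<open>X\<close>; as a subset of \<open>X\<close> it is \<open>range j\<close>.\<close>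

definition continuous_embedding ::
    "('y::complex_normed_vector \<Rightarrow> 'x::complex_normed_vector) \<Rightarrow> bool"
  where "continuous_embedding j \<longleftrightarrow> bounded_clinear j \<and> inj j"

definition dom_G :: "('y \<Rightarrow> 'x) \<Rightarrow> 'x set \<Rightarrow> ('y \<times> 'x) set"
  where "dom_G j domA = {(v, w). j v \<in> domA \<and> w \<in> range j}"

text \<open>On \<open>dom_G j domA\<close> the vector \<open>- B v + w\<close> lies in \<open>range j\<close> when \<open>B(dom A) \<subseteq> range j\<close>;
  \<open>inv j\<close> reads it as an element of \<open>Y\<close>.\<close>

definition op_G ::
    "('y \<Rightarrow> 'x::complex_normed_vector) \<Rightarrow> ('x \<Rightarrow> 'x) \<Rightarrow> ('x \<Rightarrow> 'x) \<Rightarrow> 'y \<times> 'x \<Rightarrow> 'y \<times> 'x"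
  where "op_G j A B = (\<lambda>(v, w). (inv j (- B (j v) + w), (A (j v) + B (B (j v))) - B w))"

definition T12 :: "(real \<Rightarrow> 'y::zero \<times> 'x \<Rightarrow> 'y \<times> 'x) \<Rightarrow> real \<Rightarrow> 'x \<Rightarrow> 'y"
  where "T12 T t x = fst (T t (0, x))"

definition T22 :: "(real \<Rightarrow> 'y::zero \<times> 'x \<Rightarrow> 'y \<times> 'x) \<Rightarrow> real \<Rightarrow> 'x \<Rightarrow> 'x"
  where "T22 T t x = snd (T t (0, x))"

definition gen_cosine ::
    "('y::complex_banach \<Rightarrow> 'x::complex_banach) \<Rightarrow> ('x \<Rightarrow> 'x) \<Rightarrow>
      (real \<Rightarrow> 'y \<times> 'x \<Rightarrow> 'y \<times> 'x) \<Rightarrow> real \<Rightarrow> 'x \<Rightarrow> 'x"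
  where "gen_cosine j B T t x = T22 T t x - B (j (T12 T t x)) + 2 *\<^sub>R j (T12 T t (B x))"

definition gen_sine ::
    "('y::complex_banach \<Rightarrow> 'x::complex_banach) \<Rightarrow>
      (real \<Rightarrow> 'y \<times> 'x \<Rightarrow> 'y \<times> 'x) \<Rightarrow> real \<Rightarrow> 'x \<Rightarrow> 'x"
  where "gen_sine j T t x = j (T12 T t x)"


section \<open>Integral mild solutions\<close>

text \<open>Oriented integral; the library's interval integral would force \<open>X\<close> to be separable.\<close>

definition ivl_integral :: "real \<Rightarrow> real \<Rightarrow> (real \<Rightarrow> 'a::banach) \<Rightarrow> 'a"
  where "ivl_integral a b f = (if a \<le> b then integral {a..b} f else - integral {b..a} f)"

definition integral_mild_solution ::
    "'x::complex_banach set \<Rightarrow> ('x \<Rightarrow> 'x) \<Rightarrow> 'x set \<Rightarrow> ('x \<Rightarrow> 'x) \<Rightarrow>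
      'x \<Rightarrow> 'x \<Rightarrow> (real \<Rightarrow> 'x) \<Rightarrow> bool"
  where "integral_mild_solution domA A domB B x y u \<longleftrightarrow>
    continuous_on UNIV u \<and>
    (\<forall>t. ivl_integral 0 t u \<in> domB) \<and>
    (\<forall>t. ivl_integral 0 t (\<lambda>s. (t - s) *\<^sub>R u s) \<in> domA) \<and>
    continuous_on UNIV (\<lambda>t. B (ivl_integral 0 t u)) \<and>
    continuous_on UNIV (\<lambda>t. A (ivl_integral 0 t (\<lambda>s. (t - s) *\<^sub>R u s))) \<and>
    (\<forall>t. u t + 2 *\<^sub>R B (ivl_integral 0 t u) =
      A (ivl_integral 0 t (\<lambda>s. (t - s) *\<^sub>R u s)) + x + t *\<^sub>R (y + 2 *\<^sub>R B x))"

end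

theory Submission
  imports Defs
begin

text \<open>Existence: applying the generator to the first and second integrals of the orbit
  \<open>\<T>(t)(0, w)\<close> and reading off components gives \<open>A\<close> and \<open>B\<close> on the integrals of \<open>T\<^sub>1\<^sub>2(t)w\<close>.  With
  \<open>w = x\<close> and \<open>w = y + 2Bx\<close> these identities add up to the mild equation; continuity needs that
  \<open>B\<close> restricted to \<open>Y\<close> is bounded from \<open>Y\<close> to \<open>X\<close>, by the closed graph theorem.
  Uniqueness: three integrations turn a solution of the homogeneous problem into a classical
  solution of \<open>z' = G z\<close>, \<open>z(0) = 0\<close>, which vanishes.  Its \<open>Y\<close>-valued differentiability comes from
  the closed graph theorem for the inclusion of \<open>dom(A)\<close> with the graph norm into \<open>Y\<close>.\<close>

section \<open>The closed graph theorem\<close>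

text \<open>Baire's theorem makes the closure of some sublevel set of \<open>norm (L x)\<close> a
  neighbourhood relative to \<open>S\<close>; successive approximation then removes the closure.
  \<open>L\<close> need only behave linearly on the closed subspace \<open>S\<close>, so
  \<open>S\<close> may be the graph of an unbounded operator.\<close>

lemma closed_graph_theorem:
  fixes S :: "'a::banach set" and L :: "'a \<Rightarrow> 'b::banach"
  assumes S: "subspace S" "closed S"
    and add: "\<And>x y. x \<in> S \<Longrightarrow> y \<in> S \<Longrightarrow> L (x + y) = L x + L y"
    and scale: "\<And>c x. x \<in> S \<Longrightarrow> L (c *\<^sub>R x) = c *\<^sub>R L x"
    and graph: "\<And>f x y. (\<And>n::nat. f n \<in> S) \<Longrightarrow> f \<longlonglongrightarrow> x \<Longrightarrow> (\<lambda>n. L (f n)) \<longlonglongrightarrow> y \<Longrightarrow> L x = y"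
  shows "\<exists>K>0. \<forall>x\<in>S. norm (L x) \<le> K * norm x"
proof -
  have diff: "L (x - y) = L x - L y" if "x \<in> S" "y \<in> S" for x y
    using add[of x "- y"] scale[of y "- 1"] that S(1) by (simp add: subspace_neg)
  define C where "C n = closure {x \<in> S. norm (L x) \<le> real n}" for n
  have C_sub: "C n \<subseteq> S" for n
    unfolding C_def using S(2) by (simp add: closure_minimal)
  have S_Un: "(\<Union>n. C n) = S"
  proof
    show "S \<subseteq> (\<Union>n. C n)"
    proof
      fix x assume "x \<in> S"
      obtain n where "norm (L x) \<le> real n" using real_arch_simple by blast
      with \<open>x \<in> S\<close> have "x \<in> C n" unfolding C_def by (intro subsetD[OF closure_subset]) auto
      then show "x \<in> (\<Union>n. C n)" by blast
    qed
  qed (use C_sub in blast)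
  \<comment> \<open>If every \<open>C n\<close> had empty relative interior, Baire would make the
    relative interior of their union empty; but the union is \<open>S\<close>, which contains
    0.\<close>
  have "\<exists>n. top_of_set S interior_of C n \<noteq> {}"
  proof (rule ccontr)
    assume neg: "\<nexists>n. top_of_set S interior_of C n \<noteq> {}"
    have "top_of_set S interior_of \<Union>(range C) = {}"
    proof (rule Baire_category_alt)
      show "completely_metrizable_space (top_of_set S) \<or>
          locally_compact_space (top_of_set S) \<and> regular_space (top_of_set S)"
        using S(2) completely_metrizable_space_closedin completely_metrizable_space_euclidean
        by (metis closed_closedin)
    next
      fix U assume "U \<in> range C"
      then show "closedin (top_of_set S) U \<and> top_of_set S interior_of U = {}"
        using neg C_sub closed_subset[of "C _" S] by (force simp: C_def)
    qed simp
    then have "S = {}"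
      using S_Un interior_of_topspace[of "top_of_set S"] by simp
    then show False using S(1) subspace_0 by blast
  qed
  then obtain n x0 where "x0 \<in> top_of_set S interior_of C n" by blast
  then obtain U where U: "openin (top_of_set S) U" "x0 \<in> U" "U \<subseteq> C n"
    unfolding interior_of_def by blast
  then obtain r where r: "r > 0" "ball x0 r \<inter> S \<subseteq> C n"
    by (meson openin_contains_ball subset_trans)
  have x0: "x0 \<in> S" "x0 \<in> C n" using U C_sub by blast+
  \<comment> \<open>Vectors near 0 are approximated by differences of two vectors from the sublevel
    set for \<open>n\<close>, so the bound doubles.\<close>
  define N where "N = 2 * real n"
  \<comment> \<open>Both \<open>x0 + v\<close> and \<open>x0\<close> lie in the closure
    \<open>C n\<close>; subtracting nearby points of the sublevel set approximates
    \<open>v\<close>.\<close>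
  have approx: "\<exists>u\<in>S. norm (L u) \<le> N \<and> norm (v - u) < e"
    if v: "v \<in> S" "norm v < r" and e: "e > 0" for v e
  proof -
    have "x0 + v \<in> C n" using r v x0 S(1) by (auto simp: dist_norm subspace_add)
    then obtain a where a: "a \<in> S" "norm (L a) \<le> real n" "dist a (x0 + v) < e/2"
      unfolding C_def closure_approachable using e half_gt_zero by blast
    obtain b where b: "b \<in> S" "norm (L b) \<le> real n" "dist b x0 < e/2"
      using x0(2) unfolding C_def closure_approachable using e half_gt_zero by blast
    have "norm (L (a - b)) \<le> N"
      using diff[OF a(1) b(1)] a(2) b(2) norm_triangle_ineq4[of "L a" "L b"] by (simp add: N_def)
    moreover have "v - (a - b) = (b - x0) - (a - (x0 + v))" by simp
    then have "norm (v - (a - b)) \<le> norm (b - x0) + norm (a - (x0 + v))"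
      by (metis norm_triangle_ineq4)
    then have "norm (v - (a - b)) < e" using a(3) b(3) by (simp add: dist_norm)
    ultimately show ?thesis using a b S(1) by (meson subspace_diff)
  qed
  have scaled: "\<exists>u\<in>S. norm (L u) \<le> N * c \<and> norm (v - u) < e"
    if v: "v \<in> S" "norm v < r * c" and "e > 0" "c > 0" for v e c
  proof -
    have "norm (v /\<^sub>R c) < r" using v \<open>c > 0\<close> by (simp add: field_simps)
    then obtain u where u: "u \<in> S" "norm (L u) \<le> N" "norm (v /\<^sub>R c - u) < e / c"
      using approx[OF subspace_scale[OF S(1) v(1)] _ divide_pos_pos[OF \<open>e > 0\<close> \<open>c > 0\<close>]] by blast
    have "v - c *\<^sub>R u = c *\<^sub>R (v /\<^sub>R c - u)" using \<open>c > 0\<close> by (simp add: algebra_simps)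
    then have "norm (v - c *\<^sub>R u) = c * norm (v /\<^sub>R c - u)" using \<open>c > 0\<close> by simp
    also have "\<dots> < e" using u(3) \<open>c > 0\<close> by (simp add: field_simps)
    finally have "norm (v - c *\<^sub>R u) < e" .
    moreover have "norm (L (c *\<^sub>R u)) \<le> N * c"
      using u \<open>c > 0\<close> by (simp add: scale mult.commute)
    ultimately show ?thesis using u(1) S(1) by (meson subspace_scale)
  qed
  \<comment> \<open>Correct the residual \<open>w\<^sub>k\<close> approximately, halving it each time; since \<open>w\<^sub>k \<rightarrow> 0\<close>, closedness makes
    \<open>L v = \<Sum>k. (L w\<^sub>k - L w\<^sub>k\<^sub>+\<^sub>1)\<close>.\<close>
  have bound: "norm (L v) \<le> 2 * N" if v: "v \<in> S" "norm v < r" for v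
  proof -
    have "\<exists>w. \<forall>k. (w k \<in> S \<and> norm (w k) < r * (1/2)^k \<and> (k = 0 \<longrightarrow> w k = v))
        \<and> norm (L (w k) - L (w (Suc k))) \<le> N * (1/2)^k"
    proof (rule dependent_nat_choice)
      show "\<exists>x. x \<in> S \<and> norm x < r * (1/2)^0 \<and> (0 = (0::nat) \<longrightarrow> x = v)" using v by simp
    next
      fix x :: 'a and k :: nat
      assume x: "x \<in> S \<and> norm x < r * (1/2)^k \<and> (k = 0 \<longrightarrow> x = v)"
      then obtain u where u: "u \<in> S" "norm (L u) \<le> N * (1/2)^k" "norm (x - u) < r * (1/2)^Suc k"
        using scaled[of x "(1/2)^k" "r * (1/2)^Suc k"] r by auto
      then have "L x - L (x - u) = L u" using x by (simp add: diff)
      then show "\<exists>y. (y \<in> S \<and> norm y < r * (1/2)^Suc k \<and> (Suc k = 0 \<longrightarrow> y = v)) \<and>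
          norm (L x - L y) \<le> N * (1/2)^k"
        using u x S(1) by (intro exI[of _ "x - u"]) (auto simp: subspace_diff)
    qed
    then obtain w where w: "\<And>k. w k \<in> S" "\<And>k. norm (w k) < r * (1/2)^k" "w 0 = v"
        "\<And>k. norm (L (w k) - L (w (Suc k))) \<le> N * (1/2)^k"
      by metis
    have geo: "(\<lambda>k. N * (1/2)^k) sums (2 * N)"
      using sums_mult[OF geometric_sums[of "1/2::real"], of N] by (simp add: mult.commute)
    have sm: "summable (\<lambda>k. L (w k) - L (w (Suc k)))"
      by (rule summable_comparison_test'[OF sums_summable[OF geo] w(4)])
    have w0: "w \<longlonglongrightarrow> 0"
    proof (rule Lim_null_comparison)
      show "\<forall>\<^sub>F k in sequentially. norm (w k) \<le> r * (1/2)^k" using w(2) by (simp add: less_imp_le)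
      show "(\<lambda>k. r * (1/2)^k) \<longlonglongrightarrow> 0"
        by (intro tendsto_mult_right_zero LIMSEQ_power_zero) simp
    qed
    define s where "s = (\<Sum>k. L (w k) - L (w (Suc k)))"
    have "(\<lambda>m. \<Sum>k<m. L (w k) - L (w (Suc k))) \<longlonglongrightarrow> s"
      using sm by (simp add: s_def summable_LIMSEQ)
    then have "(\<lambda>m. L v - L (w m)) \<longlonglongrightarrow> s"
      by (simp only: sum_lessThan_telescope'[of "\<lambda>k. L (w k)"] w(3))
    \<comment> \<open>This isolates the convergence of \<open>L (w m)\<close> to
      \<open>L v - s\<close>. Since \<open>w\<close> tends to 0, the closed graph forces
      \<open>L 0 = L v - s\<close>.\<close>
    then have "(\<lambda>m. L v - (L v - L (w m))) \<longlonglongrightarrow> L v - s"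
      by (intro tendsto_intros)
    then have "L 0 = L v - s" using graph[OF w(1) w0] by simp
    moreover have "L 0 = 0" using scale[OF subspace_0[OF S(1)], of 0] by simp
    ultimately have "L v = s" by simp
    moreover have "norm s \<le> 2 * N"
      unfolding s_def using norm_suminf_le[OF w(4) sums_summable[OF geo]] sums_unique[OF geo] by simp
    ultimately show ?thesis by simp
  qed
  \<comment> \<open>Rescaling \<open>x\<close> to norm \<open>r / 2\<close> gives the factor
    \<open>4 * N / r\<close>; the added 1 keeps the constant positive when
    \<open>N = 0\<close>.\<close>
  have "norm (L x) \<le> (4 * N / r + 1) * norm x" if x: "x \<in> S" for x
  proof (cases "x = 0")
    case True
    then show ?thesis using scale[of 0 0] x by simp
  next
    case False
    define c where "c = r / (2 * norm x)"
    have c: "c > 0" using False r by (simp add: c_def)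
    have "norm (c *\<^sub>R x) < r" using False r by (simp add: c_def)
    then have "norm (L (c *\<^sub>R x)) \<le> 2 * N" using bound x S(1) by (meson subspace_scale)
    then have "c * norm (L x) \<le> 2 * N" using x c by (simp add: scale)
    then have "norm (L x) \<le> 4 * N / r * norm x" using False r by (simp add: c_def field_simps)
    then show ?thesis by (simp add: distrib_right add_increasing2)
  qed
  moreover have "4 * N / r + 1 > 0" using r by (simp add: N_def add_nonneg_pos)
  ultimately show ?thesis by blast
qed

section \<open>Antiderivatives on the real line\<close>

lemma antiderivative_unique:
  fixes F G :: "real \<Rightarrow> 'a::real_normed_vector"
  assumes "\<And>t. (F has_vector_derivative f t) (at t)" "\<And>t. (G has_vector_derivative f t) (at t)"
    and "F a = G a"
  shows "F = G"
proof -
  have "((\<lambda>t. F t - G t) has_vector_derivative 0) (at t)" for t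
    using has_vector_derivative_diff[OF assms(1,2)] by simp
  then obtain c where "\<And>t. F t - G t = c"
    using has_vector_derivative_zero_constant[of UNIV "\<lambda>t. F t - G t"] by auto
  with assms(3) show ?thesis by (metis eq_iff_diff_eq_0 ext)
qed

lemma ivl_integral_self [simp]: "ivl_integral a a f = 0"
  by (simp add: ivl_integral_def)

text \<open>Up to a constant, the oriented integral is an ordinary one starting at a point
  \<open>c\<close> below both \<open>a\<close> and \<open>t\<close>, so both orientations follow
  from the one-sided fundamental theorem.\<close>

lemma ivl_integral_has_vector_derivative:
  fixes f :: "real \<Rightarrow> 'a::banach"
  assumes "continuous_on UNIV f"
  shows "((\<lambda>t. ivl_integral a t f) has_vector_derivative f t) (at t)"
proof -
  obtain c where c: "c < a" "c < t"
    by (metis lt_ex min_less_iff_conj)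
  have cont: "continuous_on I f" for I using assms continuous_on_subset by blast
  have eq: "integral {c..s} f - integral {c..a} f = ivl_integral a s f" if "s > c" for s
  proof (cases "a \<le> s")
    case True
    then have "integral {c..s} f = integral {c..a} f + integral {a..s} f"
      using c by (intro Henstock_Kurzweil_Integration.integral_combine[symmetric] integrable_continuous_real cont) auto
    with True show ?thesis by (simp add: ivl_integral_def algebra_simps)
  next
    case False
    then have "integral {c..a} f = integral {c..s} f + integral {s..a} f"
      using that by (intro Henstock_Kurzweil_Integration.integral_combine[symmetric] integrable_continuous_real cont) auto
    with False show ?thesis by (simp add: ivl_integral_def algebra_simps)
  qed
  have "((\<lambda>s. integral {c..s} f) has_vector_derivative f t) (at t within {c..t + 1})"
    by (intro integral_has_vector_derivative cont) (use c in auto)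
  moreover have "at t within {c..t + 1} = at t" by (rule at_within_Icc_at) (use c in auto)
  ultimately have "((\<lambda>s. integral {c..s} f) has_vector_derivative f t) (at t)" by simp
  from has_vector_derivative_diff[OF this has_vector_derivative_const[of "integral {c..a} f"]]
  have "((\<lambda>s. integral {c..s} f - integral {c..a} f) has_vector_derivative f t) (at t)" by simp
  then show ?thesis
    by (rule has_vector_derivative_transform_within_open[of _ _ _ "{c<..}"]) (use c eq in auto)
qed

lemma ivl_integral_eqI:
  fixes F f :: "real \<Rightarrow> 'a::banach"
  assumes "\<And>t. (F has_vector_derivative f t) (at t)" "continuous_on UNIV f" "F a = 0"
  shows "ivl_integral a t f = F t"
  using antiderivative_unique[OF ivl_integral_has_vector_derivative[OF assms(2)] assms(1), of a a] assms(3)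
  by (auto dest: fun_cong)

lemma has_vector_derivative_imp_continuous_on:
  assumes "\<And>t. (F has_vector_derivative f t) (at t)"
  shows "continuous_on S F"
  by (meson assms continuous_at_imp_continuous_on has_vector_derivative_continuous)

text \<open>Integration by parts: \<open>(t - s) *\<^sub>R I s + II s\<close> is an antiderivative
  in \<open>s\<close> of the weighted integrand, is 0 at \<open>s = 0\<close> and equals
  \<open>II t\<close> at \<open>s = t\<close>.\<close>

lemma ivl_integral_iterated:
  fixes u :: "real \<Rightarrow> 'a::banach"
  assumes "continuous_on UNIV u"
    and I: "\<And>t. (I has_vector_derivative u t) (at t)" "I 0 = 0"
    and II: "\<And>t. (II has_vector_derivative I t) (at t)" "II 0 = 0"
  shows "ivl_integral 0 t (\<lambda>s. (t - s) *\<^sub>R u s) = II t"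
proof -
  have "((\<lambda>s. (t - s) *\<^sub>R I s + II s) has_vector_derivative (t - s) *\<^sub>R u s) (at s)" for s
    by (rule derivative_eq_intros I II refl | simp)+
  from ivl_integral_eqI[OF this] I(2) II(2) assms(1) show ?thesis
    by (simp add: continuous_intros)
qed

text \<open>Riemann sums are linear combinations of values of \<open>f\<close>, hence lie in
  \<open>S\<close>, and they approximate the integral.\<close>

lemma has_integral_closed_subspace:
  fixes f :: "real \<Rightarrow> 'a::real_normed_vector"
  assumes "(f has_integral I) {a..b}" "subspace S" "closed S" "\<And>x. x \<in> {a..b} \<Longrightarrow> f x \<in> S"
  shows "I \<in> S"
proof -
  have "\<exists>y\<in>S. dist y I < e" if "e > 0" for e
  proof -
    from assms(1)[unfolded has_integral_real, rule_format, OF that] obtain \<gamma> where \<gamma>: "gauge \<gamma>"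
      and sum: "\<forall>\<D>. \<D> tagged_division_of {a..b} \<and> \<gamma> fine \<D> \<longrightarrow>
        norm ((\<Sum>(x,k)\<in>\<D>. measure lborel k *\<^sub>R f x) - I) < e"
      by (elim exE conjE)
    obtain \<D> where \<D>: "\<D> tagged_division_of {a..b}" "\<gamma> fine \<D>"
      using fine_division_exists_real[OF \<gamma>] .
    have "(\<Sum>(x,k)\<in>\<D>. measure lborel k *\<^sub>R f x) \<in> S"
    proof (rule subspace_sum[OF assms(2)])
      fix xk assume "xk \<in> \<D>"
      moreover obtain x k where "xk = (x, k)" by fastforce
      ultimately show "(case xk of (x, k) \<Rightarrow> measure lborel k *\<^sub>R f x) \<in> S"
        using assms(2,4) tag_in_interval[OF \<D>(1)] by (simp add: subspace_scale)
    qed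
    with sum \<D> show ?thesis unfolding dist_norm by blast
  qed
  then show ?thesis using assms(3) closure_approachable closure_closed by blast
qed

lemma antiderivative_closed_subspace:
  fixes F :: "real \<Rightarrow> 'a::banach"
  assumes F: "\<And>t. (F has_vector_derivative f t) (at t)" "F 0 = 0"
    and S: "subspace S" "closed S" "\<And>t. f t \<in> S"
  shows "F t \<in> S"
proof (cases "0 \<le> t")
  case True
  then show ?thesis
    using has_integral_closed_subspace[OF fundamental_theorem_of_calculus[of 0 t F f] S(1,2)] F S(3)
    by (simp add: has_vector_derivative_at_within)
next
  case False
  then have "- F t \<in> S"
    using has_integral_closed_subspace[OF fundamental_theorem_of_calculus[of t 0 F f] S(1,2)] F S(3)
    by (simp add: has_vector_derivative_at_within)
  then show ?thesis using S(1) subspace_neg by fastforce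
qed

text \<open>This is the shape of the limit in \<open>generator_graph\<close>, so membership there
  can be exchanged with differentiability at 0.\<close>

lemma has_vector_derivative_iff_diff_quotient:
  "(f has_vector_derivative d) (at t) \<longleftrightarrow> ((\<lambda>h. (f (t + h) - f t) /\<^sub>R h) \<longlongrightarrow> d) (at 0)"
proof -
  have eq: "norm (f (t + h) - f t - h *\<^sub>R d) / norm h = norm ((f (t + h) - f t) /\<^sub>R h - d)"
    if "h \<noteq> 0" for h
  proof -
    have "(f (t + h) - f t) /\<^sub>R h - d = (f (t + h) - f t - h *\<^sub>R d) /\<^sub>R h"
      using that by (simp add: algebra_simps)
    then show ?thesis by (simp add: divide_inverse mult.commute)
  qed
  have "((\<lambda>h. norm (f (t + h) - f t - h *\<^sub>R d) / norm h) \<longlongrightarrow> 0) (at 0) \<longleftrightarrow>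
      ((\<lambda>h. norm ((f (t + h) - f t) /\<^sub>R h - d)) \<longlongrightarrow> 0) (at 0)"
    by (rule tendsto_cong) (use eq in \<open>simp add: eventually_at_filter\<close>)
  then show ?thesis
    unfolding has_vector_derivative_def has_derivative_at tendsto_norm_zero_iff LIM_zero_iff
    by (simp add: bounded_linear_scaleR_left)
qed

section \<open>Strongly continuous groups\<close>

text \<open>Makes spaces of bounded continuous functions admissible as the target space in
  \<open>closed_graph_theorem\<close>.\<close>

instance bcontfun :: (metric_space, banach) banach ..

lemma C0_groupD:
  assumes "C0_group T"
  shows "bounded_linear (T t)" "T 0 x = x" "T (s + t) x = T s (T t x)" "continuous_on S (\<lambda>t. T t x)"
  using assms continuous_on_subset[of UNIV]
  unfolding C0_group_def bounded_clinear_def by blast+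

text \<open>The closed graph theorem for \<open>x \<mapsto> (t \<mapsto> T t x)\<close>, with values in the continuous functions on
  \<open>[-1, 1]\<close>, replaces the uniform boundedness principle.\<close>

lemma C0_group_locally_bounded:
  fixes T :: "real \<Rightarrow> 'a::complex_banach \<Rightarrow> 'a"
  assumes "C0_group T"
  obtains K where "K > 0" "\<And>t x. \<bar>t\<bar> \<le> 1 \<Longrightarrow> norm (T t x) \<le> K * norm x"
proof -
  note T = C0_groupD[OF assms]
  \<comment> \<open>Clamping the time to [-1, 1] turns the orbit over a compact interval into a
    bounded continuous function on the whole line.\<close>
  define c where "c s = max (- 1) (min 1 s)" for s :: real
  have c: "continuous_on UNIV c" unfolding c_def by (intro continuous_intros)
  define L where "L x = Bcontfun (\<lambda>s. T (c s) x)" for x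
  have bcont: "(\<lambda>s. T (c s) x) \<in> bcontfun" for x
  proof -
    have "bounded ((\<lambda>t. T t x) ` {-1..1})"
      by (intro compact_imp_bounded compact_continuous_image T(4)) simp
    then have "bounded (range (\<lambda>s. T (c s) x))"
      by (rule bounded_subset) (auto simp: c_def)
    moreover have "continuous_on UNIV (\<lambda>s. T (c s) x)"
      by (rule continuous_on_compose2[OF T(4)[of UNIV] c]) simp
    ultimately show ?thesis by (simp add: bcontfun_def)
  qed
  then have L: "apply_bcontfun (L x) s = T (c s) x" for x s
    by (simp add: L_def Bcontfun_inverse)
  have "\<exists>K>0. \<forall>x\<in>UNIV. norm (L x) \<le> K * norm x"
  proof (rule closed_graph_theorem[of UNIV L])
    show "L (x + y) = L x + L y" for x y
      by (rule bcontfun_eqI) (simp add: L linear_simps(1)[OF T(1)])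
    show "L (r *\<^sub>R x) = r *\<^sub>R L x" for r x
      by (rule bcontfun_eqI) (simp add: L linear_simps(5)[OF T(1)])
  next
    fix f :: "nat \<Rightarrow> 'a" and x g
    assume f: "f \<longlonglongrightarrow> x" and g: "(\<lambda>n. L (f n)) \<longlonglongrightarrow> g"
    show "L x = g"
    proof (rule bcontfun_eqI)
      fix s
      \<comment> \<open>The graph is closed because uniform limits are pointwise limits, while at
        each fixed time the bounded operator \<open>T (c s)\<close> already determines the
        limit.\<close>
      have "(\<lambda>n. L (f n) s) \<longlonglongrightarrow> g s"
        using tendsto_uniform_limitI[OF tendsto_bcontfun_uniform_limit[OF g]] by blast
      moreover have "(\<lambda>n. L (f n) s) \<longlonglongrightarrow> L x s"
        unfolding L by (rule bounded_linear.tendsto[OF T(1) f])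
      ultimately show "L x s = g s" using LIMSEQ_unique by blast
    qed
  qed auto
  then obtain K where K: "K > 0" "\<And>x. norm (L x) \<le> K * norm x" by blast
  show thesis
  proof
    show "norm (T t x) \<le> K * norm x" if "\<bar>t\<bar> \<le> 1" for t x
    proof -
      have "T t x = L x t" using that by (simp add: L c_def)
      then show ?thesis using norm_bounded[of "L x" t] K(2)[of x] by simp
    qed
  qed fact
qed

text \<open>Joint continuity in time and vector. After shifting by \<open>t\<close> the times
  eventually enter [-1, 1], where the uniform bound controls the error \<open>f h - a\<close>;
  strong continuity handles the fixed vector \<open>a\<close>.\<close>

lemma C0_group_tendsto:
  assumes T: "C0_group T" and f: "(f \<longlongrightarrow> a) F" and \<tau>: "(\<tau> \<longlongrightarrow> t) F"
  shows "((\<lambda>h. T (\<tau> h) (f h)) \<longlongrightarrow> T t a) F"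
proof -
  note T' = C0_groupD[OF T]
  obtain K where K: "K > 0" "\<And>t x. \<bar>t\<bar> \<le> 1 \<Longrightarrow> norm (T t x) \<le> K * norm x"
    using C0_group_locally_bounded[OF T] by blast
  have \<tau>0: "((\<lambda>h. \<tau> h - t) \<longlongrightarrow> 0) F" using \<tau> by (simp add: LIM_zero_iff)
  have "((\<lambda>h. T (\<tau> h - t) (f h - a)) \<longlongrightarrow> 0) F"
  proof (rule Lim_null_comparison)
    have "\<forall>\<^sub>F h in F. dist (\<tau> h - t) 0 < 1" using \<tau>0 by (rule tendstoD) simp
    then show "\<forall>\<^sub>F h in F. norm (T (\<tau> h - t) (f h - a)) \<le> K * norm (f h - a)"
      by eventually_elim (rule K(2), simp)
    show "((\<lambda>h. K * norm (f h - a)) \<longlongrightarrow> 0) F"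
      using f by (intro tendsto_mult_right_zero tendsto_norm_zero) (simp add: LIM_zero_iff)
  qed
  moreover have "((\<lambda>h. T (\<tau> h - t) a) \<longlongrightarrow> T 0 a) F"
    using T'(4)[of UNIV a] \<tau>0 by (rule continuous_on_tendsto_compose) auto
  ultimately have "((\<lambda>h. T (\<tau> h - t) (f h - a) + T (\<tau> h - t) a) \<longlongrightarrow> a) F"
    using tendsto_add by (fastforce simp: T'(2))
  then have "((\<lambda>h. T (\<tau> h - t) (f h)) \<longlongrightarrow> a) F"
    by (simp add: linear_simps(2)[OF T'(1)])
  then have "((\<lambda>h. T t (T (\<tau> h - t) (f h))) \<longlongrightarrow> T t a) F"
    by (rule bounded_linear.tendsto[OF T'(1)])
  then show ?thesis by (simp flip: T'(3))
qed

text \<open>Transporting the solution back along the group gives the curve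
  \<open>T (- s) (z s)\<close>, whose derivative vanishes by the product rule.\<close>

lemma generator_graph_cauchy_problem_unique:
  assumes T: "C0_group T"
    and z: "\<And>t. (z has_vector_derivative g t) (at t)" "\<And>t. (z t, g t) \<in> generator_graph T"
    and "z 0 = 0"
  shows "z t = 0"
proof -
  note T' = C0_groupD[OF T]
  note lin = linear_simps[OF T'(1)]
  have "((\<lambda>s. T (- s) (z s)) has_vector_derivative 0) (at s)" for s
  proof -
    \<comment> \<open>The increments of \<open>z\<close> and of the orbit through \<open>z s\<close>
      have the same limiting quotient \<open>g s\<close>. By the group law, their transported
      difference is the difference quotient of \<open>T (- s) (z s)\<close>.\<close>
    have "((\<lambda>h. T (- (s + h)) ((z (s + h) - z s) /\<^sub>R h)) \<longlongrightarrow> T (- s) (g s)) (at 0)"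
      using z(1)[of s] unfolding has_vector_derivative_iff_diff_quotient
      by (rule C0_group_tendsto[OF T]) (auto intro!: tendsto_eq_intros)
    moreover have "((\<lambda>h. (T h (z s) - z s) /\<^sub>R h) \<longlongrightarrow> g s) (at 0)"
      using z(2) by (simp add: generator_graph_def)
    then have "((\<lambda>h. T (- (s + h)) ((T h (z s) - z s) /\<^sub>R h)) \<longlongrightarrow> T (- s) (g s)) (at 0)"
      by (rule C0_group_tendsto[OF T]) (auto intro!: tendsto_eq_intros)
    ultimately have "((\<lambda>h. T (- (s + h)) ((z (s + h) - z s) /\<^sub>R h) -
        T (- (s + h)) ((T h (z s) - z s) /\<^sub>R h)) \<longlongrightarrow> 0) (at 0)"
      using tendsto_diff by fastforce
    moreover have "T (- (s + h)) ((z (s + h) - z s) /\<^sub>R h) - T (- (s + h)) ((T h (z s) - z s) /\<^sub>R h) =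
        (T (- (s + h)) (z (s + h)) - T (- s) (z s)) /\<^sub>R h" for h
      using T'(3)[of "- (s + h)" h "z s"]
      by (simp add: lin scaleR_diff_right)
    ultimately show ?thesis unfolding has_vector_derivative_iff_diff_quotient by simp
  qed
  then have "(\<lambda>s. T (- s) (z s)) = (\<lambda>s. 0)"
    by (rule antiderivative_unique[where a = 0]) (simp_all add: \<open>z 0 = 0\<close> lin)
  then have "T t (T (- t) (z t)) = 0" by (metis lin(3))
  then show ?thesis by (simp add: T'(2) flip: T'(3))
qed

text \<open>Applying \<open>T h\<close> to an integral of the orbit translates it in time, up to
  correction terms. The quotient defining the generator thus becomes an ordinary difference quotient
  in \<open>h\<close>. The translation identities follow by comparing derivatives in
  \<open>s\<close> and values at 0.\<close>

lemma generator_graph_iterated_integral: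
  assumes T: "C0_group T"
    and \<Phi>: "\<And>t. (\<Phi> has_vector_derivative T t z) (at t)" "\<Phi> 0 = 0"
  shows "(\<Phi> t, T t z - z) \<in> generator_graph T"
    and "\<And>\<Psi>. (\<And>t. (\<Psi> has_vector_derivative \<Phi> t) (at t)) \<Longrightarrow> \<Psi> 0 = 0 \<Longrightarrow>
      (\<Psi> t, \<Phi> t - t *\<^sub>R z) \<in> generator_graph T"
proof -
  note T' = C0_groupD[OF T]
  note lin = linear_simps[OF T'(1)]
  have shift: "((\<lambda>s. F (s + h)) has_vector_derivative f (s + h)) (at s)"
    if "\<And>t. (F has_vector_derivative f t) (at t)" for F f :: "real \<Rightarrow> 'a" and s h
    using vector_diff_chain_at[of "\<lambda>s. s + h" 1 s F "f (s + h)"] that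
    by (simp add: o_def has_vector_derivative_add_const[of "\<lambda>s. s"])
  have T_deriv: "((\<lambda>s. T h (F s)) has_vector_derivative T h (f s)) (at s)"
    if "\<And>t. (F has_vector_derivative f t) (at t)" for F f s h
    by (rule bounded_linear.has_vector_derivative[OF T'(1) that])
  have T\<Phi>: "T h (\<Phi> s) = \<Phi> (s + h) - \<Phi> h" for s h
  proof -
    have "((\<lambda>s. \<Phi> (s + h) - \<Phi> h) has_vector_derivative T h (T s z)) (at s)" for s
      using shift[OF \<Phi>(1), of h s] T'(3)[of h s z]
      by (simp add: has_vector_derivative_diff_const add.commute)
    from antiderivative_unique[OF T_deriv[OF \<Phi>(1)] this, where a = 0]
    show ?thesis by (auto simp: \<Phi>(2) lin dest: fun_cong)
  qed
  have "((\<lambda>s. \<Phi> (s + t) - \<Phi> s) has_vector_derivative T t z - z) (at 0)"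
    using has_vector_derivative_diff[OF shift[OF \<Phi>(1), where s=0 and h=t] \<Phi>(1)[of 0]] by (simp add: T'(2))
  then show "(\<Phi> t, T t z - z) \<in> generator_graph T"
    unfolding has_vector_derivative_iff_diff_quotient generator_graph_def
    by (simp add: T\<Phi> \<Phi>(2) add.commute)
  fix \<Psi> assume \<Psi>: "\<And>t. (\<Psi> has_vector_derivative \<Phi> t) (at t)" "\<Psi> 0 = 0"
  have T\<Psi>: "T h (\<Psi> s) = \<Psi> (s + h) - \<Psi> h - s *\<^sub>R \<Phi> h" for s h
  proof -
    have "((\<lambda>s. \<Psi> (s + h) - \<Psi> h - s *\<^sub>R \<Phi> h) has_vector_derivative T h (\<Phi> s)) (at s)" for s
      by (rule derivative_eq_intros shift \<Psi>(1) refl | simp add: T\<Phi>)+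
    from antiderivative_unique[OF T_deriv[OF \<Psi>(1)] this, where a = 0]
    show ?thesis by (auto simp: \<Psi>(2) lin dest: fun_cong)
  qed
  have "((\<lambda>s. \<Psi> (s + t) - \<Psi> s - t *\<^sub>R \<Phi> s) has_vector_derivative \<Phi> t - t *\<^sub>R z) (at 0)"
    by (rule derivative_eq_intros shift \<Psi>(1) \<Phi> refl | simp add: T'(2) \<Phi>(2))+
  then show "(\<Psi> t, \<Phi> t - t *\<^sub>R z) \<in> generator_graph T"
    unfolding has_vector_derivative_iff_diff_quotient generator_graph_def
    by (simp add: T\<Psi> \<Psi>(2) \<Phi>(2) add.commute algebra_simps)
qed

section \<open>Closed operators and mild solutions\<close>

lemma linear_operatorD:
  assumes "linear_operator D F"
  shows "subspace D"
    and "F 0 = 0"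
    and "x \<in> D \<Longrightarrow> y \<in> D \<Longrightarrow> F (x + y) = F x + F y"
    and "x \<in> D \<Longrightarrow> y \<in> D \<Longrightarrow> F (x - y) = F x - F y"
    and "x \<in> D \<Longrightarrow> F (- x) = - F x"
    and "x \<in> D \<Longrightarrow> F (r *\<^sub>R x) = r *\<^sub>R F x"
proof -
  show scale: "F (r *\<^sub>R x) = r *\<^sub>R F x" if "x \<in> D" for x r
    using assms that unfolding linear_operator_def scaleR_scaleC by auto
  show sub: "subspace D"
    using assms unfolding linear_operator_def subspace_def scaleR_scaleC by auto
  show add: "F (x + y) = F x + F y" if "x \<in> D" "y \<in> D" for x y
    using assms that unfolding linear_operator_def by auto
  show neg: "F (- x) = - F x" if "x \<in> D" for x
    using scale[OF that, of "- 1"] by simp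
  show "F (x - y) = F x - F y" if "x \<in> D" "y \<in> D" for x y
    using add[of x "- y"] neg[of y] that sub by (simp add: subspace_neg)
  show "F 0 = 0"
    using scale[OF subspace_0[OF sub], of 0] by simp
qed

lemma subspace_operator_graph:
  assumes "linear_operator D F"
  shows "subspace (operator_graph D F)"
  unfolding operator_graph_def subspace_def
  using linear_operatorD[OF assms] by (auto simp: zero_prod_def subspace_0 subspace_add subspace_scale)

text \<open>Hille's theorem on closed operators and integrals: the curve
  \<open>(f t, F (f t))\<close> stays in the graph, a closed subspace, so its antiderivative
  \<open>(V t, W t)\<close> does too.\<close>

lemma closed_linear_operator_antiderivative:
  fixes f :: "real \<Rightarrow> 'a::complex_banach" and F :: "'a \<Rightarrow> 'b::complex_banach"
  assumes F: "closed_linear_operator D F"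
    and V: "\<And>t. (V has_vector_derivative f t) (at t)" "V 0 = 0"
    and f: "\<And>t. f t \<in> D" "continuous_on UNIV (\<lambda>t. F (f t))"
  shows "V t \<in> D" and "((\<lambda>t. F (V t)) has_vector_derivative F (f t)) (at t)"
proof -
  define W where "W t = ivl_integral 0 t (\<lambda>s. F (f s))" for t
  have W: "(W has_vector_derivative F (f t)) (at t)" for t
    unfolding W_def by (rule ivl_integral_has_vector_derivative[OF f(2)])
  have "(V t, W t) \<in> operator_graph D F" for t
  proof (rule antiderivative_closed_subspace)
    show "((\<lambda>t. (V t, W t)) has_vector_derivative (f t, F (f t))) (at t)" for t
      by (intro has_vector_derivative_Pair V W)
    show "subspace (operator_graph D F)" "closed (operator_graph D F)"
      using F by (auto simp: closed_linear_operator_def intro: subspace_operator_graph)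
  qed (simp_all add: W_def V(2) f(1) zero_prod_def operator_graph_def)
  then have VW: "V t \<in> D" "F (V t) = W t" for t by (auto simp: operator_graph_def)
  show "V t \<in> D" by (rule VW)
  show "((\<lambda>t. F (V t)) has_vector_derivative F (f t)) (at t)" using W by (simp add: VW)
qed

text \<open>Lets any antiderivatives vanishing at 0 replace the integrals in the definition, so
  explicit ones serve for existence and differences of them for uniqueness.\<close>

lemma integral_mild_solution_iff:
  assumes "continuous_on UNIV u"
    and V1: "\<And>t. (V1 has_vector_derivative u t) (at t)" "V1 0 = 0"
    and V2: "\<And>t. (V2 has_vector_derivative V1 t) (at t)" "V2 0 = 0"
  shows "integral_mild_solution domA A domB B x y u \<longleftrightarrow>
    (\<forall>t. V1 t \<in> domB) \<and> (\<forall>t. V2 t \<in> domA) \<and>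
    continuous_on UNIV (\<lambda>t. B (V1 t)) \<and> continuous_on UNIV (\<lambda>t. A (V2 t)) \<and>
    (\<forall>t. u t + 2 *\<^sub>R B (V1 t) = A (V2 t) + x + t *\<^sub>R (y + 2 *\<^sub>R B x))"
  unfolding integral_mild_solution_def ivl_integral_iterated[OF assms] ivl_integral_eqI[OF V1(1) assms(1) V1(2)]
  using assms(1) by simp

section \<open>The operator matrix\<close>

locale operator_matrix_group =
  fixes domA domB :: "'x::complex_banach set"
    and A B :: "'x \<Rightarrow> 'x"
    and j :: "'y::complex_banach \<Rightarrow> 'x"
    and T :: "real \<Rightarrow> 'y \<times> 'x \<Rightarrow> 'y \<times> 'x"
  assumes closed_A: "closed_linear_operator domA A"
    and closed_B: "closed_linear_operator domB B"
    and j_embedding: "continuous_embedding j"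
    and domA_subset: "domA \<subseteq> dom_square domB B \<inter> range j"
    and B_domA_subset: "B ` domA \<subseteq> range j"
    and range_j_subset: "range j \<subseteq> domB"
    and generates: "generates_C0_group (dom_G j domA) (op_G j A B) T"
begin

lemma group_T: "C0_group T"
  using generates by (simp add: generates_C0_group_def)

lemma bounded_linear_j: "bounded_linear j"
  using j_embedding by (simp add: continuous_embedding_def bounded_clinear_def)

lemma inj_j: "inj j"
  using j_embedding by (simp add: continuous_embedding_def)

lemmas j_simps = linear_simps[OF bounded_linear_j]

lemma linear_A: "linear_operator domA A" and linear_B: "linear_operator domB B"
  using closed_A closed_B by (auto simp: closed_linear_operator_def)

lemmas A_simps = linear_operatorD[OF linear_A]
lemmas B_simps = linear_operatorD[OF linear_B]

lemma j_in_domB: "j v \<in> domB"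
  using range_j_subset by blast

lemma inv_j: "x \<in> domA \<Longrightarrow> j (inv j x) = x"
  using domA_subset by (auto intro: f_inv_into_f)

lemma in_domB: "x \<in> domA \<Longrightarrow> x \<in> domB" and B_in_domB: "x \<in> domA \<Longrightarrow> B x \<in> domB"
  using domA_subset by (auto simp: dom_square_def)

lemma subspace_range_j: "subspace (range j)"
  by (simp add: bounded_linear.linear bounded_linear_j linear_subspace_image)

section \<open>Estimates in the norm of Y\<close>

lemma bounded_linear_B_j: "bounded_linear (\<lambda>v. B (j v))"
proof -
  have add: "B (j (v + w)) = B (j v) + B (j w)" and scale: "B (j (r *\<^sub>R v)) = r *\<^sub>R B (j v)" for v w r
    by (simp_all add: j_simps B_simps j_in_domB)
  have "\<exists>K>0. \<forall>v\<in>UNIV. norm (B (j v)) \<le> K * norm v"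
  proof (rule closed_graph_theorem)
    fix f v g
    assume "f \<longlonglongrightarrow> v" and g: "(\<lambda>n. B (j (f n))) \<longlonglongrightarrow> g"
    \<comment> \<open>Continuity of \<open>j\<close> carries the limit from Y to X, where the closed
      graph of \<open>B\<close> identifies it.\<close>
    then have lim: "(\<lambda>n. (j (f n), B (j (f n)))) \<longlonglongrightarrow> (j v, g)"
      by (intro tendsto_Pair bounded_linear.tendsto[OF bounded_linear_j])
    have graph: "(j (f n), B (j (f n))) \<in> operator_graph domB B" for n
      using j_in_domB by (auto simp: operator_graph_def)
    have "closed (operator_graph domB B)"
      using closed_B by (simp add: closed_linear_operator_def)
    then have "(j v, g) \<in> operator_graph domB B"
      by (rule closed_sequentially[OF _ graph lim])
    then show "B (j v) = g" by (auto simp: operator_graph_def)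
  qed (auto simp: add scale)
  then obtain K where "\<And>v. norm (B (j v)) \<le> norm v * K" by (auto simp: mult.commute)
  then show ?thesis using add scale by (intro bounded_linear_intro)
qed

text \<open>Closed graph theorem for \<open>inv j\<close> on the graph of \<open>A\<close>, a Banach space.\<close>

lemma continuous_on_inv_j:
  assumes V: "\<And>t. V t \<in> domA" "continuous_on UNIV V" "continuous_on UNIV (\<lambda>t. A (V t))"
  shows "continuous_on UNIV (\<lambda>t::real. inv j (V t))"
proof -
  have inv_add: "inv j (x + y) = inv j x + inv j y" if "x \<in> domA" "y \<in> domA" for x y
    using that by (intro injD[OF inj_j]) (simp add: j_simps inv_j subspace_add A_simps(1))
  have inv_scale: "inv j (r *\<^sub>R x) = r *\<^sub>R inv j x" if "x \<in> domA" for x r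
    using that by (intro injD[OF inj_j]) (simp add: j_simps inv_j subspace_scale A_simps(1))
  have inv_diff: "inv j (x - y) = inv j x - inv j y" if "x \<in> domA" "y \<in> domA" for x y
    using that by (intro injD[OF inj_j]) (simp add: j_simps inv_j subspace_diff A_simps(1))
  let ?S = "operator_graph domA A"
  have "\<exists>K>0. \<forall>z\<in>?S. norm (inv j (fst z)) \<le> K * norm z"
  proof (rule closed_graph_theorem[where L = "\<lambda>z. inv j (fst z)"])
    show S: "subspace ?S" and closed: "closed ?S"
      using subspace_operator_graph[OF linear_A] closed_A by (auto simp: closed_linear_operator_def)
    fix f z v
    assume f: "\<And>n. f n \<in> ?S" "f \<longlonglongrightarrow> z" and v: "(\<lambda>n. inv j (fst (f n))) \<longlonglongrightarrow> v"
    \<comment> \<open>A limit taken in Y is also a limit in X, so injectivity of \<open>j\<close>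
      identifies it with the preimage of \<open>fst z\<close>.\<close>
    have "(\<lambda>n. j (inv j (fst (f n)))) \<longlonglongrightarrow> j v"
      by (rule bounded_linear.tendsto[OF bounded_linear_j v])
    moreover have "j (inv j (fst (f n))) = fst (f n)" for n
      using f(1)[of n] by (auto simp: operator_graph_def inv_j)
    ultimately have "j v = fst z"
      using tendsto_fst[OF f(2)] LIMSEQ_unique by simp blast
    then show "inv j (fst z) = v" using inj_j by (metis inv_f_f)
  qed (auto simp: operator_graph_def inv_add inv_scale)
  then obtain K where K: "\<And>x. x \<in> domA \<Longrightarrow> norm (inv j x) \<le> K * norm (x, A x)"
    by (force simp: operator_graph_def)
  have "((\<lambda>t. inv j (V t)) \<longlongrightarrow> inv j (V s)) (at s)" for s
  proof -
    have "((\<lambda>t. inv j (V t) - inv j (V s)) \<longlongrightarrow> 0) (at s)"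
    proof (rule Lim_null_comparison)
      show "\<forall>\<^sub>F t in at s. norm (inv j (V t) - inv j (V s)) \<le> K * norm (V t - V s, A (V t) - A (V s))"
        using K[OF subspace_diff[OF A_simps(1) V(1) V(1)]]
        by (simp add: inv_diff V(1) A_simps(4))
      have "((\<lambda>t. V t - V s) \<longlongrightarrow> 0) (at s)" "((\<lambda>t. A (V t) - A (V s)) \<longlongrightarrow> 0) (at s)"
        using V(2,3) by (simp_all add: continuous_on_def LIM_zero_iff)
      then have "((\<lambda>t. K * norm (V t - V s, A (V t) - A (V s))) \<longlongrightarrow> K * norm (0::'x, 0::'x)) (at s)"
        by (intro tendsto_intros)
      then show "((\<lambda>t. K * norm (V t - V s, A (V t) - A (V s))) \<longlongrightarrow> 0) (at s)"
        by (simp add: norm_Pair)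
    qed
    then show ?thesis by (simp add: LIM_zero_iff)
  qed
  then show ?thesis by (simp add: continuous_on_def)
qed

section \<open>The generator in components and existence of a mild solution\<close>

lemma generator_graph_iff:
  "((v, w), (v', w')) \<in> generator_graph T \<longleftrightarrow>
    j v \<in> domA \<and> w \<in> range j \<and> j v' = - B (j v) + w \<and> w' = A (j v) + B (B (j v)) - B w"
proof -
  have "- B (j v) + w \<in> range j" if "j v \<in> domA" "w \<in> range j"
    using that B_domA_subset
    by (intro subspace_add[OF subspace_range_j] subspace_neg[OF subspace_range_j]) auto
  \<comment> \<open>As the vector lies in \<open>range j\<close> and \<open>j\<close> is injective,
    the first row of the matrix can be read as an equation in X.\<close>
  then have "v' = inv j (- B (j v) + w) \<longleftrightarrow> j v' = - B (j v) + w" if "j v \<in> domA" "w \<in> range j"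
    using that inj_j by (metis f_inv_into_f inv_f_f)
  then show ?thesis
    using generates by (auto simp: generates_C0_group_def operator_graph_def dom_G_def op_G_def)
qed

text \<open>With \<open>z = (0, w)\<close> and first and second orbit integrals
  \<open>\<Phi>\<close>, \<open>\<Psi>\<close>, the generator maps \<open>\<Phi> t\<close> to
  \<open>T t z - z\<close> and \<open>\<Psi> t\<close> to \<open>\<Phi> t - t *\<^sub>R z\<close>.
  The first rows express the X components of both integrals through \<open>B\<close>; inserting them
  in the second rows cancels the terms with the square of \<open>B\<close>.\<close>

lemma orbit_antiderivatives:
  obtains P R Q where
    "\<And>t. (P has_vector_derivative T12 T t w) (at t)" "P 0 = 0"
    "\<And>t. (R has_vector_derivative P t) (at t)" "R 0 = 0"
    "\<And>t. (Q has_vector_derivative T22 T t w) (at t)" "Q 0 = 0"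
    "\<And>t. Q t = j (T12 T t w) + B (j (P t))"
    "\<And>t. j (P t) \<in> domA" "\<And>t. A (j (P t)) = T22 T t w - w + B (j (T12 T t w))"
    "\<And>t. j (R t) \<in> domA" "\<And>t. A (j (R t)) = j (T12 T t w) + 2 *\<^sub>R B (j (P t)) - t *\<^sub>R w"
proof -
  define \<Phi> where "\<Phi> t = ivl_integral 0 t (\<lambda>s. T s (0, w))" for t
  define \<Psi> where "\<Psi> t = ivl_integral 0 t \<Phi>" for t
  have \<Phi>: "(\<Phi> has_vector_derivative T t (0, w)) (at t)" for t
    unfolding \<Phi>_def by (intro ivl_integral_has_vector_derivative C0_groupD(4)[OF group_T])
  have \<Psi>: "(\<Psi> has_vector_derivative \<Phi> t) (at t)" for t
    unfolding \<Psi>_def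
    by (intro ivl_integral_has_vector_derivative has_vector_derivative_imp_continuous_on[OF \<Phi>])
  have zero: "\<Phi> 0 = 0" "\<Psi> 0 = 0" by (simp_all add: \<Phi>_def \<Psi>_def)
  note fst_deriv = bounded_linear.has_vector_derivative[OF bounded_linear_fst]
  note snd_deriv = bounded_linear.has_vector_derivative[OF bounded_linear_snd]
  define P R Q where "P t = fst (\<Phi> t)" and "R t = fst (\<Psi> t)" and "Q t = snd (\<Phi> t)" for t
  have "((P t, Q t), (T12 T t w, T22 T t w - w)) \<in> generator_graph T" for t
    using generator_graph_iterated_integral(1)[OF group_T \<Phi> zero(1), of t]
    by (cases "T t (0, w)") (simp add: P_def Q_def T12_def T22_def)
  then have PQ: "j (P t) \<in> domA" "j (T12 T t w) = - B (j (P t)) + Q t"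
      "T22 T t w - w = A (j (P t)) + B (B (j (P t))) - B (Q t)" for t
    unfolding generator_graph_iff by blast+
  have "((R t, snd (\<Psi> t)), (P t, Q t - t *\<^sub>R w)) \<in> generator_graph T" for t
    using generator_graph_iterated_integral(2)[OF group_T \<Phi> zero(1) \<Psi> zero(2), of t]
    by (cases "\<Phi> t") (simp add: P_def Q_def R_def)
  then have R: "j (R t) \<in> domA" "j (P t) = - B (j (R t)) + snd (\<Psi> t)"
      "Q t - t *\<^sub>R w = A (j (R t)) + B (B (j (R t))) - B (snd (\<Psi> t))" for t
    unfolding generator_graph_iff by blast+
  have Q: "Q t = j (T12 T t w) + B (j (P t))" for t using PQ(2)[of t] by simp
  have "B (Q t) = B (j (T12 T t w)) + B (B (j (P t)))" for t
    unfolding Q using PQ(1) by (intro B_simps(3) j_in_domB B_in_domB)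
  then have AP: "A (j (P t)) = T22 T t w - w + B (j (T12 T t w))" for t
    using PQ(3)[of t] by simp
  have "B (snd (\<Psi> t)) = B (j (P t)) + B (B (j (R t)))" for t
    using R(2)[of t] B_simps(3)[OF j_in_domB B_in_domB[OF R(1)[of t]], of "P t"] by simp
  then have AR: "A (j (R t)) = j (T12 T t w) + 2 *\<^sub>R B (j (P t)) - t *\<^sub>R w" for t
    using R(3)[of t] Q[of t] by (simp add: scaleR_2 algebra_simps)
  show thesis
  proof (rule that[of P R Q])
    show "(P has_vector_derivative T12 T t w) (at t)" "(Q has_vector_derivative T22 T t w) (at t)"
      "(R has_vector_derivative P t) (at t)" for t
      unfolding P_def Q_def R_def T12_def T22_def by (intro fst_deriv snd_deriv \<Phi> \<Psi>)+
    show "P 0 = 0" "Q 0 = 0" "R 0 = 0" by (simp_all add: P_def Q_def R_def zero)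
  qed (fact Q PQ(1) R(1) AP AR)+
qed

lemma integral_mild_solution_cosine_sine:
  "integral_mild_solution domA A domB B x y (\<lambda>t. gen_cosine j B T t x + gen_sine j T t y)"
proof -
  \<comment> \<open>The coefficient of \<open>t\<close> in the mild equation. Its orbit component
    \<open>T12 T t ?w\<close> collects the sine term and the last term of the cosine.\<close>
  let ?w = "2 *\<^sub>R B x + y"
  obtain P1 R1 Q1 where P1: "\<And>t. (P1 has_vector_derivative T12 T t x) (at t)" "P1 0 = 0"
    and Q1: "\<And>t. (Q1 has_vector_derivative T22 T t x) (at t)" "Q1 0 = 0"
      "\<And>t. Q1 t = j (T12 T t x) + B (j (P1 t))"
    and AP1: "\<And>t. j (P1 t) \<in> domA" "\<And>t. A (j (P1 t)) = T22 T t x - x + B (j (T12 T t x))"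
    using orbit_antiderivatives[of x] by metis
  obtain P2 R2 Q2 where P2: "\<And>t. (P2 has_vector_derivative T12 T t ?w) (at t)" "P2 0 = 0"
    and R2: "\<And>t. (R2 has_vector_derivative P2 t) (at t)" "R2 0 = 0"
    and AR2: "\<And>t. j (R2 t) \<in> domA"
      "\<And>t. A (j (R2 t)) = j (T12 T t ?w) + 2 *\<^sub>R B (j (P2 t)) - t *\<^sub>R ?w"
    using orbit_antiderivatives[of ?w] by metis
  have T12_cont: "continuous_on UNIV (\<lambda>t. T12 T t z)" and T22_cont: "continuous_on UNIV (\<lambda>t. T22 T t z)" for z
    unfolding T12_def T22_def by (intro continuous_intros C0_groupD(4)[OF group_T])+
  have pair: "(0, ?w) = 2 *\<^sub>R (0, B x) + (0, y)" by simp
  have T12_w: "T12 T t ?w = 2 *\<^sub>R T12 T t (B x) + T12 T t y" for t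
    unfolding T12_def pair linear_simps(1,5)[OF C0_groupD(1)[OF group_T]] by simp
  define u where "u t = T22 T t x - B (j (T12 T t x)) + j (T12 T t ?w)" for t
  \<comment> \<open>First and second antiderivatives of \<open>u\<close>. The part from
    \<open>x\<close> integrates to \<open>j (T12 T t x)\<close>, since this equals
    \<open>Q1 t - B (j (P1 t))\<close>; hence \<open>P1\<close> serves in \<open>V2\<close> for
    \<open>x\<close>, whereas \<open>?w\<close> needs \<open>R2\<close>.\<close>
  define V1 where "V1 t = j (T12 T t x) + j (P2 t)" for t
  define V2 where "V2 t = j (P1 t) + j (R2 t)" for t
  note j_deriv = bounded_linear.has_vector_derivative[OF bounded_linear_j]
  note Bj_deriv = bounded_linear.has_vector_derivative[OF bounded_linear_B_j]
  note j_cont = bounded_linear.continuous_on[OF bounded_linear_j]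
  note Bj_cont = bounded_linear.continuous_on[OF bounded_linear_B_j]
  have u: "(\<lambda>t. gen_cosine j B T t x + gen_sine j T t y) = u"
    by (simp add: fun_eq_iff u_def gen_cosine_def gen_sine_def T12_w j_simps)
  have u_cont: "continuous_on UNIV u"
    unfolding u_def by (intro continuous_intros T22_cont j_cont Bj_cont T12_cont)
  have "V1 = (\<lambda>t. Q1 t - B (j (P1 t)) + j (P2 t))"
    by (simp add: fun_eq_iff V1_def Q1(3))
  then have V1: "(V1 has_vector_derivative u t) (at t)" "V1 0 = 0" for t
    unfolding u_def using Q1(2) P1(2) P2(2)
    by (auto intro!: has_vector_derivative_add has_vector_derivative_diff Q1(1) Bj_deriv P1(1) j_deriv P2(1)
        simp: j_simps B_simps(2))
  have V2: "(V2 has_vector_derivative V1 t) (at t)" "V2 0 = 0" for t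
    unfolding V2_def V1_def using P1(2) R2(2)
    by (auto intro!: has_vector_derivative_add j_deriv P1(1) R2(1) simp: j_simps)
  have V1_domB: "V1 t \<in> domB" for t
    unfolding V1_def by (intro subspace_add B_simps(1) j_in_domB)
  have BV1: "B (V1 t) = B (j (T12 T t x)) + B (j (P2 t))" for t
    unfolding V1_def by (simp add: B_simps(3) j_in_domB)
  have V2_domA: "V2 t \<in> domA" for t
    unfolding V2_def by (intro subspace_add A_simps(1) AP1 AR2)
  have AV2: "A (V2 t) = T22 T t x - x + B (j (T12 T t x)) +
      (j (T12 T t ?w) + 2 *\<^sub>R B (j (P2 t)) - t *\<^sub>R ?w)" for t
    unfolding V2_def by (simp add: A_simps(3) AP1 AR2)
  have P2_cont: "continuous_on UNIV P2"
    by (rule has_vector_derivative_imp_continuous_on[OF P2(1)])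
  show ?thesis
    unfolding u integral_mild_solution_iff[OF u_cont V1 V2]
  proof (intro conjI allI V1_domB V2_domA)
    show "continuous_on UNIV (\<lambda>t. B (V1 t))"
      unfolding BV1 by (intro continuous_intros Bj_cont T12_cont P2_cont)
    show "continuous_on UNIV (\<lambda>t. A (V2 t))"
      unfolding AV2 by (intro continuous_intros T22_cont j_cont Bj_cont T12_cont P2_cont)
    show "u t + 2 *\<^sub>R B (V1 t) = A (V2 t) + x + t *\<^sub>R (y + 2 *\<^sub>R B x)" for t
      unfolding u_def BV1 AV2 by (simp add: scaleR_2 algebra_simps)
  qed
qed

section \<open>Uniqueness of the mild solution\<close>

text \<open>With the iterated integrals \<open>V\<^sub>1, V\<^sub>2, V\<^sub>3\<close> of \<open>u\<close>, the pair \<open>(V\<^sub>3, V\<^sub>2 + B V\<^sub>3)\<close> is a classical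
  solution of \<open>z' = G z\<close>, \<open>z(0) = 0\<close>.  Three integrations are needed because only \<open>V\<^sub>2\<close>, not \<open>V\<^sub>1\<close>, is
  known to lie in \<open>Y\<close>.\<close>

lemma integral_mild_solution_zero:
  assumes u: "integral_mild_solution domA A domB B 0 0 u"
  shows "u t = 0"
proof -
  have u_cont: "continuous_on UNIV u" using u by (simp add: integral_mild_solution_def)
  define V1 where "V1 t = ivl_integral 0 t u" for t
  define V2 where "V2 t = ivl_integral 0 t V1" for t
  define V3 where "V3 t = ivl_integral 0 t V2" for t
  have V1: "(V1 has_vector_derivative u t) (at t)" "V1 0 = 0" for t
    unfolding V1_def using ivl_integral_has_vector_derivative[OF u_cont] by simp_all
  have V2: "(V2 has_vector_derivative V1 t) (at t)" "V2 0 = 0" for t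
    unfolding V2_def
    using ivl_integral_has_vector_derivative[OF has_vector_derivative_imp_continuous_on[OF V1(1)]]
    by simp_all
  note V2_cont = has_vector_derivative_imp_continuous_on[OF V2(1)]
  have V3: "(V3 has_vector_derivative V2 t) (at t)" "V3 0 = 0" for t
    unfolding V3_def using ivl_integral_has_vector_derivative[OF V2_cont] by simp_all
  have V1_domB: "V1 t \<in> domB" and V2_domA: "V2 t \<in> domA"
    and BV1_cont: "continuous_on UNIV (\<lambda>t. B (V1 t))" and AV2_cont: "continuous_on UNIV (\<lambda>t. A (V2 t))"
    and eq: "u t + 2 *\<^sub>R B (V1 t) = A (V2 t)" for t
    using u unfolding integral_mild_solution_iff[OF u_cont V1 V2] by (auto simp: B_simps(2))
  note BV2 = closed_linear_operator_antiderivative(2)[OF closed_B V2 V1_domB BV1_cont]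
  note BV3 = closed_linear_operator_antiderivative(2)[OF closed_B V3 in_domB[OF V2_domA]
      has_vector_derivative_imp_continuous_on[OF BV2]]
  note V3_domA = closed_linear_operator_antiderivative(1)[OF closed_A V3 V2_domA AV2_cont]
  note AV3 = closed_linear_operator_antiderivative(2)[OF closed_A V3 V2_domA AV2_cont]
  \<comment> \<open>The mild equation integrated once. It supplies the second component of
    \<open>z' = G z\<close>, where the squares of \<open>B\<close> cancel.\<close>
  have "((\<lambda>t. V1 t + 2 *\<^sub>R B (V2 t)) has_vector_derivative A (V2 t)) (at t)" for t
    unfolding eq[symmetric]
    by (intro has_vector_derivative_add V1
        bounded_linear.has_vector_derivative[OF bounded_linear_scaleR_right] BV2)
  then have "(\<lambda>t. V1 t + 2 *\<^sub>R B (V2 t)) = (\<lambda>t. A (V3 t))"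
    by (rule antiderivative_unique[OF _ AV3, where a = 0]) (simp add: V1 V2 V3 A_simps(2) B_simps(2))
  then have integrated_eq: "V1 t + 2 *\<^sub>R B (V2 t) = A (V3 t)" for t by metis
  \<comment> \<open>\<open>\<nu>\<close> is \<open>V2\<close> read in Y. Taking \<open>\<mu>\<close>
    as its integral in Y, rather than as the preimage of \<open>V3\<close>, gives differentiability
    in the norm of Y at once; \<open>j\<close> then carries \<open>\<mu>\<close> to
    \<open>V3\<close>.\<close>
  define \<nu> where "\<nu> t = inv j (V2 t)" for t
  define \<mu> where "\<mu> t = ivl_integral 0 t \<nu>" for t
  have \<nu>: "j (\<nu> t) = V2 t" for t by (simp add: \<nu>_def inv_j V2_domA)
  have "continuous_on UNIV \<nu>"
    unfolding \<nu>_def by (rule continuous_on_inv_j[OF V2_domA V2_cont AV2_cont])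
  then have \<mu>: "(\<mu> has_vector_derivative \<nu> t) (at t)" "\<mu> 0 = 0" for t
    unfolding \<mu>_def by (simp_all add: ivl_integral_has_vector_derivative)
  have "(\<lambda>t. j (\<mu> t)) = V3"
    by (rule antiderivative_unique[OF _ V3(1), where a = 0])
      (use bounded_linear.has_vector_derivative[OF bounded_linear_j \<mu>(1)] in
        \<open>simp_all add: \<nu> \<mu>(2) V3(2) j_simps\<close>)
  then have j\<mu>: "j (\<mu> t) = V3 t" for t by metis
  have "(\<mu> t, V2 t + B (V3 t)) = 0" for t
  proof (rule generator_graph_cauchy_problem_unique[OF group_T])
    fix t
    show "((\<lambda>t. (\<mu> t, V2 t + B (V3 t))) has_vector_derivative (\<nu> t, V1 t + B (V2 t))) (at t)"
      by (intro has_vector_derivative_Pair has_vector_derivative_add \<mu> V2 BV3)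
    have "V2 t \<in> range j" "B (V3 t) \<in> range j"
      using domA_subset B_domA_subset V2_domA V3_domA by blast+
    then have "V2 t + B (V3 t) \<in> range j" by (rule subspace_add[OF subspace_range_j])
    moreover have "B (V2 t + B (V3 t)) = B (V2 t) + B (B (V3 t))"
      by (intro B_simps(3) in_domB V2_domA B_in_domB V3_domA)
    ultimately show "((\<mu> t, V2 t + B (V3 t)), (\<nu> t, V1 t + B (V2 t))) \<in> generator_graph T"
      unfolding generator_graph_iff j\<mu> \<nu> using V3_domA integrated_eq[of t, symmetric]
      by (simp add: scaleR_2)
  qed (simp add: \<mu>(2) V2(2) V3(2) B_simps(2) zero_prod_def)
  then have "\<mu> t = 0" for t by (simp add: zero_prod_def)
  then have "V3 = (\<lambda>t. 0)" using j\<mu> by (metis j_simps(3))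
  then have "V2 = (\<lambda>t. 0)" using vector_derivative_unique_at[OF V3(1)] by auto
  then have "V1 = (\<lambda>t. 0)" using vector_derivative_unique_at[OF V2(1)] by auto
  then show "u t = 0" using vector_derivative_unique_at[OF V1(1)] by auto
qed

text \<open>The difference of two solutions solves the problem with zero data: differences of
  antiderivatives are antiderivatives, and \<open>A\<close> and \<open>B\<close> split over them
  because both terms lie in the domains.\<close>

lemma integral_mild_solution_unique:
  assumes u: "integral_mild_solution domA A domB B x y u"
    and v: "integral_mild_solution domA A domB B x y v"
  shows "u = v"
proof -
  have cont: "continuous_on UNIV u" "continuous_on UNIV v"
    using u v by (auto simp: integral_mild_solution_def)
  have antiderivatives: "\<exists>V1 V2. (\<forall>t. (V1 has_vector_derivative f t) (at t)) \<and> V1 0 = 0 \<and>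
      (\<forall>t. (V2 has_vector_derivative V1 t) (at t)) \<and> V2 0 = 0"
    if "continuous_on UNIV f" for f :: "real \<Rightarrow> 'x"
  proof -
    note V1 = ivl_integral_has_vector_derivative[OF that, of 0]
    note V2 = ivl_integral_has_vector_derivative[OF has_vector_derivative_imp_continuous_on[OF V1], of 0]
    show ?thesis
      by (rule exI[of _ "\<lambda>t. ivl_integral 0 t f"], rule exI[of _ "\<lambda>t. ivl_integral 0 t (\<lambda>t. ivl_integral 0 t f)"])
        (simp add: V1 V2)
  qed
  obtain U1 U2 where U1: "\<And>t. (U1 has_vector_derivative u t) (at t)" "U1 0 = 0"
    and U2: "\<And>t. (U2 has_vector_derivative U1 t) (at t)" "U2 0 = 0"
    using antiderivatives[OF cont(1)] by metis
  obtain V1 V2 where V1: "\<And>t. (V1 has_vector_derivative v t) (at t)" "V1 0 = 0"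
    and V2: "\<And>t. (V2 has_vector_derivative V1 t) (at t)" "V2 0 = 0"
    using antiderivatives[OF cont(2)] by metis
  note u' = u[unfolded integral_mild_solution_iff[OF cont(1) U1 U2]]
  note v' = v[unfolded integral_mild_solution_iff[OF cont(2) V1 V2]]
  have B_diff: "B (U1 t - V1 t) = B (U1 t) - B (V1 t)" for t using u' v' by (simp add: B_simps(4))
  have A_diff: "A (U2 t - V2 t) = A (U2 t) - A (V2 t)" for t using u' v' by (simp add: A_simps(4))
  have "integral_mild_solution domA A domB B 0 0 (\<lambda>t. u t - v t)"
  proof (subst integral_mild_solution_iff)
    show "continuous_on UNIV (\<lambda>t. u t - v t)" by (intro continuous_intros cont)
    show "((\<lambda>t. U1 t - V1 t) has_vector_derivative u t - v t) (at t)" for t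
      by (intro has_vector_derivative_diff U1 V1)
    show "((\<lambda>t. U2 t - V2 t) has_vector_derivative U1 t - V1 t) (at t)" for t
      by (intro has_vector_derivative_diff U2 V2)
    have "u t - v t + 2 *\<^sub>R (B (U1 t) - B (V1 t)) = A (U2 t) - A (V2 t)" for t
    proof -
      have "u t + 2 *\<^sub>R B (U1 t) - (v t + 2 *\<^sub>R B (V1 t)) = A (U2 t) - A (V2 t)"
        using u' v' by simp
      then show ?thesis by (simp add: algebra_simps)
    qed
    then show "(\<forall>t. U1 t - V1 t \<in> domB) \<and> (\<forall>t. U2 t - V2 t \<in> domA) \<and>
        continuous_on UNIV (\<lambda>t. B (U1 t - V1 t)) \<and> continuous_on UNIV (\<lambda>t. A (U2 t - V2 t)) \<and>
        (\<forall>t. u t - v t + 2 *\<^sub>R B (U1 t - V1 t) = A (U2 t - V2 t) + 0 + t *\<^sub>R (0 + 2 *\<^sub>R B 0))"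
      using u' v' unfolding B_diff A_diff
      by (simp add: continuous_on_diff subspace_diff A_simps(1) B_simps(1,2))
  qed (simp_all add: U1 V1 U2 V2)
  then show ?thesis using integral_mild_solution_zero by (metis eq_iff_diff_eq_0 ext)
qed

end

theorem theorem4p9:
  fixes domA domB :: "'x::complex_banach set"
    and A B :: "'x \<Rightarrow> 'x"
    and j :: "'y::complex_banach \<Rightarrow> 'x"
    and T :: "real \<Rightarrow> 'y \<times> 'x \<Rightarrow> 'y \<times> 'x"
  assumes "closed_linear_operator domA A"
    and "closed_linear_operator domB B"
    and "resolvent_set domB B \<noteq> {}"
    and "continuous_embedding j"
    and "domA \<subseteq> dom_square domB B \<inter> range j"
    and "B ` domA \<subseteq> range j"
    and "range j \<subseteq> domB"
    and "generates_C0_group (dom_G j domA) (op_G j A B) T"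
  shows "\<forall>x\<in>domB. \<forall>y.
    (\<exists>!u. integral_mild_solution domA A domB B x y u) \<and>
    integral_mild_solution domA A domB B x y
      (\<lambda>t. gen_cosine j B T t x + gen_sine j T t y)"
proof -
  interpret operator_matrix_group domA domB A B j T
    using assms by unfold_locales
  show ?thesis
    using integral_mild_solution_cosine_sine integral_mild_solution_unique by blast
qed

end
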